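(* Let $K$ be a field and let $f,g,h$ be nonzero multivariate Dirichlet polynomials in the indeterminates $s_1,\dots,s_n$ with coefficients in $K$ such that $f=g\cdot h$. Then $NP^{log}(f)=NP^{log}(g)+NP^{log}(h)$ (Minkowski sum).
   Context: A multivariate Dirichlet polynomial over $K$ is a finite sum $f=\sum_{(i_1,\dots,i_n)\in S_f}\frac{a_{i_1,\dots,i_n}}{i_1^{s_1}\cdots i_n^{s_n}}$ with nonzero $a_{i_1,\dots,i_n}\in K$ and support $S_f\subset(\mathbb Z_{>0})^n$ finite; products are defined by $\frac{a}{j_1^{s_1}\cdots j_n^{s_n}}\cdot\frac{b}{k_1^{s_1}\cdots k_n^{s_n}}=\frac{ab}{(j_1k_1)^{s_1}\cdots(j_nk_n)^{s_n}}$ extended bilinearly. The logarithmic support is $S_f^{log}=\{(\log i_1,\dots,\log i_n):(i_1,\dots,i_n)\in S_f\}\subset\mathbb R^n$, and the Newton log-polytope $NP^{log}(f)$ is the convex hull of $S_f^{log}$. The Minkowski sum of $A,B\subseteq\mathbb R^n$ is $\{x+y:x\in A,y\in B\}$. *)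

theory Defs
  imports "HOL-Analysis.Analysis"
begin

text \<open>A Dirichlet polynomial is represented by its coefficient function: the value at
  \<open>i = (i\<^sub>1, \<dots>, i\<^sub>n)\<close> is the coefficient of \<open>1 / (i\<^sub>1\<^bsup>s\<^sub>1\<^esup> \<cdots> i\<^sub>n\<^bsup>s\<^sub>n\<^esup>)\<close>. The indeterminates are indexed
  by the finite type \<open>'n\<close>.\<close>

typedef (overloaded) ('a, 'n) dirichlet_poly =
  "{c :: nat ^ 'n::finite \<Rightarrow> 'a::zero. finite {i. c i \<noteq> 0} \<and> (\<forall>i k. c i \<noteq> 0 \<longrightarrow> 0 < i $ k)}"
  morphisms dcoeff Abs_dirichlet_poly
  by (rule exI[of _ "\<lambda>_. 0"]) simp

setup_lifting type_definition_dirichlet_poly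

definition dsupport :: "('a::zero, 'n::finite) dirichlet_poly \<Rightarrow> (nat ^ 'n) set" where
  "dsupport f = {i. dcoeff f i \<noteq> 0}"

lemma finite_dsupport: "finite (dsupport f)"
  unfolding dsupport_def by transfer simp

lemma dsupport_pos: "i \<in> dsupport f \<Longrightarrow> 0 < i $ k"
  unfolding dsupport_def by transfer auto

instantiation dirichlet_poly :: (zero, finite) zero
begin
lift_definition zero_dirichlet_poly :: "('a, 'b) dirichlet_poly" is "\<lambda>_. 0" by simp
instance ..
end

instantiation dirichlet_poly :: (monoid_add, finite) plus
begin
lift_definition plus_dirichlet_poly ::
    "('a, 'b) dirichlet_poly \<Rightarrow> ('a, 'b) dirichlet_poly \<Rightarrow> ('a, 'b) dirichlet_poly"
  is "\<lambda>f g i. f i + g i"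
proof -
  fix f g :: "nat ^ 'b \<Rightarrow> 'a"
  assume f: "finite {i. f i \<noteq> 0} \<and> (\<forall>i k. f i \<noteq> 0 \<longrightarrow> 0 < i $ k)"
    and g: "finite {i. g i \<noteq> 0} \<and> (\<forall>i k. g i \<noteq> 0 \<longrightarrow> 0 < i $ k)"
  have *: "f i \<noteq> 0 \<or> g i \<noteq> 0" if "f i + g i \<noteq> 0" for i
    using that by (cases "f i = 0") simp_all
  then have "{i. f i + g i \<noteq> 0} \<subseteq> {i. f i \<noteq> 0} \<union> {i. g i \<noteq> 0}"
    by blast
  then have "finite {i. f i + g i \<noteq> 0}"
    using f g by (meson finite_UnI finite_subset)
  then show "finite {i. f i + g i \<noteq> 0} \<and> (\<forall>i k. f i + g i \<noteq> 0 \<longrightarrow> 0 < i $ k)"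
    using * f g by blast
qed
instance ..
end

text \<open>The index product \<open>j * k\<close> below is the componentwise product of vectors.\<close>

instantiation dirichlet_poly :: (semiring_0, finite) times
begin
lift_definition times_dirichlet_poly ::
    "('a, 'b) dirichlet_poly \<Rightarrow> ('a, 'b) dirichlet_poly \<Rightarrow> ('a, 'b) dirichlet_poly"
  is "\<lambda>g h i. \<Sum>(j, k) \<in> {(j, k). g j \<noteq> 0 \<and> h k \<noteq> 0 \<and> j * k = i}. g j * h k"
proof -
  fix g h :: "nat ^ 'b \<Rightarrow> 'a"
  let ?c = "\<lambda>i. \<Sum>(j, k) \<in> {(j, k). g j \<noteq> 0 \<and> h k \<noteq> 0 \<and> j * k = i}. g j * h k"
  let ?S = "{i. g i \<noteq> 0}" and ?T = "{i. h i \<noteq> 0}"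
  assume g: "finite ?S \<and> (\<forall>i k. g i \<noteq> 0 \<longrightarrow> 0 < i $ k)"
    and h: "finite ?T \<and> (\<forall>i k. h i \<noteq> 0 \<longrightarrow> 0 < i $ k)"
  have *: "\<exists>j k. g j \<noteq> 0 \<and> h k \<noteq> 0 \<and> i = j * k" if "?c i \<noteq> 0" for i
  proof -
    have "{(j, k). g j \<noteq> 0 \<and> h k \<noteq> 0 \<and> j * k = i} \<noteq> {}"
    proof
      assume empty: "{(j, k). g j \<noteq> 0 \<and> h k \<noteq> 0 \<and> j * k = i} = {}"
      show False
        using that unfolding empty sum.empty by (rule notE) (rule refl)
    qed
    then show ?thesis by blast
  qed
  have "{i. ?c i \<noteq> 0} \<subseteq> (\<lambda>(j, k). j * k) ` (?S \<times> ?T)"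
  proof
    fix i assume "i \<in> {i. ?c i \<noteq> 0}"
    then obtain j k where "g j \<noteq> 0" "h k \<noteq> 0" "i = j * k"
      using *[of i] by blast
    then show "i \<in> (\<lambda>(j, k). j * k) ` (?S \<times> ?T)"
      by (intro image_eqI[of _ _ "(j, k)"]) simp_all
  qed
  then have "finite {i. ?c i \<noteq> 0}"
    by (rule finite_subset) (use g h in simp)
  moreover have "\<forall>i k. ?c i \<noteq> 0 \<longrightarrow> 0 < i $ k"
  proof (intro allI impI)
    fix i k assume ci: "?c i \<noteq> 0"
    obtain j l where "g j \<noteq> 0" "h l \<noteq> 0" "i = j * l"
      using *[OF ci] by blast
    then show "0 < i $ k"
      using g h by (simp add: times_vec_def)
  qed
  ultimately show "finite {i. ?c i \<noteq> 0} \<and> (\<forall>i k. ?c i \<noteq> 0 \<longrightarrow> 0 < i $ k)" ..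
qed
instance ..
end

lemma dcoeff_times:
  "dcoeff (g * h) i =
    (\<Sum>(j, k) \<in> {(j, k). j \<in> dsupport g \<and> k \<in> dsupport h \<and> j * k = i}. dcoeff g j * dcoeff h k)"
  unfolding dsupport_def by transfer simp

lemma dcoeff_times_superset:
  assumes "finite A" "finite B" "dsupport g \<subseteq> A" "dsupport h \<subseteq> B"
  shows "dcoeff (g * h) i = (\<Sum>j\<in>A. \<Sum>k\<in>B. if j * k = i then dcoeff g j * dcoeff h k else 0)"
proof -
  have "dcoeff (g * h) i =
      (\<Sum>(j, k) \<in> A \<times> B. if j * k = i then dcoeff g j * dcoeff h k else 0)"
    unfolding dcoeff_times
    by (rule sum.mono_neutral_cong_left)
       (use assms in \<open>auto simp: dsupport_def split: if_splits\<close>)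
  then show ?thesis
    by (simp add: sum.cartesian_product)
qed

lemma dcoeff_plus: "dcoeff (f + g) i = dcoeff f i + dcoeff g i"
  by transfer simp

lemma dsupport_plus: "dsupport (f + g) \<subseteq> dsupport f \<union> dsupport g"
  by (auto simp: dsupport_def dcoeff_plus)

text \<open>The monomial constructor and the three lemmas after it confirm that the product is the
  biadditive extension of the product of monomials. \<open>dmonom a j\<close> is \<open>0\<close> unless \<open>j\<close> is a vector of
  positive integers.\<close>

lift_definition dmonom :: "'a::zero \<Rightarrow> nat ^ 'n::finite \<Rightarrow> ('a, 'n) dirichlet_poly"
  is "\<lambda>a j i. if i = j \<and> (\<forall>k. 0 < j $ k) then a else 0"
proof -
  fix a :: 'a and j :: "nat ^ 'n"
  have "{i. (if i = j \<and> (\<forall>k. 0 < j $ k) then a else 0) \<noteq> 0} \<subseteq> {j}"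
    by auto
  then have "finite {i. (if i = j \<and> (\<forall>k. 0 < j $ k) then a else 0) \<noteq> 0}"
    by (rule finite_subset) simp
  then show "finite {i. (if i = j \<and> (\<forall>k. 0 < j $ k) then a else 0) \<noteq> 0} \<and>
      (\<forall>i k. (if i = j \<and> (\<forall>k. 0 < j $ k) then a else 0) \<noteq> 0 \<longrightarrow> 0 < i $ k)"
    by simp
qed

lemma dmonom_times:
  fixes a b :: "'a::semiring_0"
  assumes "\<And>l. 0 < j $ l" "\<And>l. 0 < k $ l"
  shows "dmonom a j * dmonom b k = dmonom (a * b) (\<chi> l. j $ l * k $ l)"
proof -
  have jk: "(\<chi> l. j $ l * k $ l) = j * k"
    by (simp add: times_vec_def)
  have pos: "0 < (j * k) $ l" for l
    using assms by (simp add: times_vec_def)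
  have m: "dcoeff (dmonom c p) i = (if i = p then c else 0)" if "\<And>l. 0 < p $ l"
    for c :: 'a and p i
    using that by (simp add: dmonom.rep_eq)
  have "dcoeff (dmonom a j * dmonom b k) i = dcoeff (dmonom (a * b) (j * k)) i" for i
  proof -
    have "dsupport (dmonom a j) \<subseteq> {j}" "dsupport (dmonom b k) \<subseteq> {k}"
      by (auto simp: dsupport_def m assms)
    then show ?thesis
      by (auto simp: dcoeff_times_superset[of "{j}" "{k}"] m assms pos)
  qed
  then show ?thesis
    unfolding jk by (intro dcoeff_inject[THEN iffD1] ext)
qed

lemma dirichlet_poly_distrib_right:
  fixes f g h :: "('a::semiring_0, 'n::finite) dirichlet_poly"
  shows "(f + g) * h = f * h + g * h"
proof -
  let ?A = "dsupport f \<union> dsupport g" and ?B = "dsupport h"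
  have fin: "finite ?A" "finite ?B"
    by (simp_all add: finite_dsupport)
  have expand: "dcoeff (u * h) i =
      (\<Sum>j\<in>?A. \<Sum>k\<in>?B. if j * k = i then dcoeff u j * dcoeff h k else 0)"
    if "dsupport u \<subseteq> ?A" for u i
    by (rule dcoeff_times_superset) (use fin that in simp_all)
  have "dcoeff ((f + g) * h) i = dcoeff (f * h + g * h) i" for i
    unfolding dcoeff_plus expand[OF dsupport_plus] expand[OF Un_upper1] expand[OF Un_upper2]
      sum.distrib[symmetric]
    by (intro sum.cong refl) (simp add: dcoeff_plus distrib_right)
  then show ?thesis
    by (intro dcoeff_inject[THEN iffD1] ext)
qed

lemma dirichlet_poly_distrib_left:
  fixes f g h :: "('a::semiring_0, 'n::finite) dirichlet_poly"
  shows "h * (f + g) = h * f + h * g"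
proof -
  let ?A = "dsupport f \<union> dsupport g" and ?B = "dsupport h"
  have fin: "finite ?A" "finite ?B"
    by (simp_all add: finite_dsupport)
  have expand: "dcoeff (h * u) i =
      (\<Sum>j\<in>?B. \<Sum>k\<in>?A. if j * k = i then dcoeff h j * dcoeff u k else 0)"
    if "dsupport u \<subseteq> ?A" for u i
    by (rule dcoeff_times_superset) (use fin that in simp_all)
  have "dcoeff (h * (f + g)) i = dcoeff (h * f + h * g) i" for i
    unfolding dcoeff_plus expand[OF dsupport_plus] expand[OF Un_upper1] expand[OF Un_upper2]
      sum.distrib[symmetric]
    by (intro sum.cong refl) (simp add: dcoeff_plus distrib_left)
  then show ?thesis
    by (intro dcoeff_inject[THEN iffD1] ext)
qed

definition log_support :: "('a::zero, 'n::finite) dirichlet_poly \<Rightarrow> (real ^ 'n) set" where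
  "log_support f = (\<lambda>i. \<chi> k. ln (real (i $ k))) ` dsupport f"

definition newton_log_polytope :: "('a::zero, 'n::finite) dirichlet_poly \<Rightarrow> (real ^ 'n) set" where
  "newton_log_polytope f = convex hull (log_support f)"

end

theory Submission imports Defs begin

text \<open>An extreme point of \<open>convex hull (S + T)\<close> has only one decomposition as a sum of an element of
  \<open>S\<close> and one of \<open>T\<close>, so at the vertices of \<open>NP\<^sup>l\<^sup>o\<^sup>g(g) + NP\<^sup>l\<^sup>o\<^sup>g(h)\<close> the convolution defining a
  coefficient of \<open>g * h\<close> has a single nonzero term and nothing can cancel.\<close>

lemma extreme_point_of_sum_unique:
  fixes S T :: "'a::real_vector set"
  assumes ext: "s + t extreme_point_of C" and sub: "S + T \<subseteq> C"
    and S: "s \<in> S" "s' \<in> S" and T: "t \<in> T" "t' \<in> T" and eq: "s + t = s' + t'"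
  shows "s = s' \<and> t = t'"
proof -
  \<comment> \<open>Exchanging the summands gives two points of \<open>C\<close> whose midpoint is
    \<open>s + t\<close>. Extremality forces them to coincide, and together with \<open>eq\<close>
    this yields \<open>t = t'\<close>.\<close>
  have "s + t' \<in> C" "s' + t \<in> C"
    using sub S T by (auto intro: set_plus_intro)
  then have "s + t \<notin> open_segment (s + t') (s' + t)"
    using ext by (simp add: extreme_point_of_def)
  moreover have "midpoint (s + t') (s' + t) = s + t"
    using eq by (simp add: midpoint_eq_iff scaleR_2 algebra_simps)
  ultimately have "s + t' = s' + t"
    by (metis midpoint_in_open_segment)
  with eq have "2 *\<^sub>R t = 2 *\<^sub>R t'"
    by (simp add: scaleR_2 algebra_simps) (metis add.assoc add.commute add_left_cancel)
  with eq show ?thesis by simp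
qed

definition log_vec :: "nat ^ 'n \<Rightarrow> real ^ 'n::finite" where
  "log_vec i = (\<chi> k. ln (real (i $ k)))"

lemma log_support_eq: "log_support f = log_vec ` dsupport f"
  by (simp add: log_support_def log_vec_def)

text \<open>Turns products of indices into sums of points, so that convolution can be read in the
  additive geometry of the polytopes.\<close>

lemma log_vec_times:
  assumes "\<And>l. 0 < j $ l" "\<And>l. 0 < k $ l"
  shows "log_vec (j * k) = log_vec j + log_vec k"
  using assms by (simp add: log_vec_def vec_eq_iff times_vec_def ln_mult)

lemma log_vec_inject:
  assumes "\<And>l. 0 < j $ l" "\<And>l. 0 < k $ l" "log_vec j = log_vec k"
  shows "j = k"
  using assms by (simp add: log_vec_def vec_eq_iff)

text \<open>A nonzero coefficient needs a nonempty convolution sum. The inclusion can be strict,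
  since terms may cancel.\<close>

lemma log_support_times_subset:
  fixes g h :: "('a::semiring_0, 'n::finite) dirichlet_poly"
  shows "log_support (g * h) \<subseteq> log_support g + log_support h"
proof
  fix x assume "x \<in> log_support (g * h)"
  then obtain i where i: "dcoeff (g * h) i \<noteq> 0" and x: "x = log_vec i"
    by (auto simp: log_support_eq dsupport_def)
  have "{(j, k). j \<in> dsupport g \<and> k \<in> dsupport h \<and> j * k = i} \<noteq> {}"
    using i unfolding dcoeff_times by (metis sum.empty)
  then obtain j k where jk: "j \<in> dsupport g" "k \<in> dsupport h" "j * k = i"
    by auto
  then have "x = log_vec j + log_vec k"
    using x log_vec_times dsupport_pos by blast
  with jk show "x \<in> log_support g + log_support h"
    by (auto simp: log_support_eq intro: set_plus_intro)
qed

lemma extreme_point_in_log_support_times: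
  fixes g h :: "('a::semiring_no_zero_divisors, 'n::finite) dirichlet_poly"
  assumes ext: "x extreme_point_of (convex hull (log_support g + log_support h))"
  shows "x \<in> log_support (g * h)"
proof -
  obtain j k where j: "j \<in> dsupport g" and k: "k \<in> dsupport h"
    and x: "x = log_vec j + log_vec k"
    using extreme_point_of_convex_hull[OF ext] by (auto simp: log_support_eq elim!: set_plus_elim)
  have "j' = j \<and> k' = k"
    if j': "j' \<in> dsupport g" and k': "k' \<in> dsupport h" and eq: "j' * k' = j * k" for j' k'
  proof -
    \<comment> \<open>Taking logarithms makes a second factorization of \<open>j * k\<close> a
      second decomposition of the extreme point \<open>x\<close>.\<close>
    have "log_vec j + log_vec k = log_vec j' + log_vec k'"
      using eq j k j' k' by (metis dsupport_pos log_vec_times)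
    then have "log_vec j = log_vec j' \<and> log_vec k = log_vec k'"
      by (rule extreme_point_of_sum_unique[OF ext[unfolded x] hull_subset, rotated -1])
         (use j k j' k' in \<open>simp_all add: log_support_eq\<close>)
    then show ?thesis
      using j k j' k' by (metis dsupport_pos log_vec_inject)
  qed
  then have "{(j', k'). j' \<in> dsupport g \<and> k' \<in> dsupport h \<and> j' * k' = j * k} = {(j, k)}"
    using j k by auto
  then have "dcoeff (g * h) (j * k) = dcoeff g j * dcoeff h k"
    by (simp add: dcoeff_times)
  \<comment> \<open>The one remaining term is a product of nonzero coefficients, hence nonzero
    without zero divisors.\<close>
  then have "j * k \<in> dsupport (g * h)"
    using j k by (simp add: dsupport_def)
  moreover have "x = log_vec (j * k)"
    using x j k by (metis dsupport_pos log_vec_times)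
  ultimately show ?thesis
    by (simp add: log_support_eq)
qed

lemma newton_log_polytope_times:
  fixes g h :: "('a::semiring_no_zero_divisors, 'n::finite) dirichlet_poly"
  shows "newton_log_polytope (g * h) = newton_log_polytope g + newton_log_polytope h"
proof -
  let ?A = "log_support g + log_support h"
  have "finite ?A"
    by (simp add: log_support_eq finite_dsupport finite_set_plus)
  \<comment> \<open>The hull of a finite set is spanned by its extreme points, so it suffices that
    these survive in \<open>log_support (g * h)\<close>.\<close>
  then have "convex hull ?A = convex hull {x. x extreme_point_of (convex hull ?A)}"
    by (rule Krein_Milman_polytope)
  also have "\<dots> \<subseteq> convex hull (log_support (g * h))"
    by (intro hull_mono) (auto intro: extreme_point_in_log_support_times)
  finally have "convex hull (log_support (g * h)) = convex hull ?A"
    using hull_mono[OF log_support_times_subset] by (metis subset_antisym)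
  \<comment> \<open>Convex hulls commute with Minkowski sums.\<close>
  then show ?thesis
    by (simp add: newton_log_polytope_def convex_hull_set_plus)
qed

theorem theorem8p3:
  fixes f g h :: "('k::field, 'n::finite) dirichlet_poly"
  assumes "f \<noteq> 0" and "g \<noteq> 0" and "h \<noteq> 0"
    and "f = g * h"
  shows "newton_log_polytope f = newton_log_polytope g + newton_log_polytope h"
  unfolding assms(4) by (rule newton_log_polytope_times)

end
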